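(* Let $\mathscr M\neq\{0\}$ be a complex inner product space and let $T:\mathscr M\to\mathscr M$ be a linear operator. Then the following conditions are equivalent: (i) $T$ is algebraic and $T$ is an $m$-isometry for some $m\in\mathbb N$; (ii) $T$ is algebraic and $\|T^nh\|^2$ is a polynomial in $n$ for every $h\in\mathscr M$; (iii) $T$ has a nontrivial orthogonal decomposition $$T=(z_1I_{\mathscr M_1}+N_1)\oplus\cdots\oplus(z_\varkappa I_{\mathscr M_\varkappa}+N_\varkappa)\qquad(\varkappa\in\mathbb N),$$ where $z_1,\ldots,z_\varkappa$ are distinct elements of $\mathbb T$ and $N_j:\mathscr M_j\to\mathscr M_j$, $j=1,\ldots,\varkappa$, are nilpotent linear operators; (iv) $T$ is algebraic and there exist an isometric (equivalently, a unitary) linear operator $V:\mathscr M\to\mathscr M$ and a nilpotent linear operator $N:\mathscr M\to\mathscr M$ such that $VN=NV$ and $T=V+N$. Moreover, if (iii) holds, then $T$ is a strict $m$-isometry with $$m=\max_{j\in\{1,\ldots,\varkappa\}}\big(2\,\mathsf n(N_j)-1\big).$$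
   Context: $\mathbb T=\{z\in\mathbb C:|z|=1\}$, $\mathbb N$ is the set of positive integers, $\mathbb Z_+$ the set of nonnegative integers. $\mathscr M$ need not be complete and operators need not be bounded. A linear operator $S$ on $\mathscr M$ is algebraic if $p(S)=0$ for some nonzero $p\in\mathbb C[x]$. $S$ is an $m$-isometry ($m\in\mathbb N$) if $\sum_{k=0}^m(-1)^k\binom mk\|S^kh\|^2=0$ for all $h\in\mathscr M$; an $m$-isometry is strict if either $m=1$ and $\mathscr M\ne\{0\}$, or $m\geqslant2$ and it is not an $(m-1)$-isometry. An isometric operator is a linear $V$ with $\|Vh\|=\|h\|$ for all $h$; it is unitary if it is moreover surjective. In (iv), "equivalently" means that the condition with "isometric" and the condition with "unitary" are both equivalent to the other conditions. A linear operator $N$ is nilpotent if $N^k=0$ for some $k\in\mathbb N$; its index of nilpotency $\mathsf n(N)$ is the $k\in\mathbb N$ with $N^k=0$ and $N^{k-1}\neq0$ (with $N^0=I$). The decomposition in (iii) corresponds to an orthogonal decomposition $\mathscr M=\mathscr M_1\oplus\cdots\oplus\mathscr M_\varkappa$ into mutually orthogonal $T$-invariant vector subspaces (every vector is a sum of vectors from the $\mathscr M_j$), with $T|_{\mathscr M_j}=z_jI_{\mathscr M_j}+N_j$; nontrivial means $\mathscr M_j\neq\{0\}$ for all $j$. A complex sequence $\{\gamma_n\}_{n=0}^\infty$ is a polynomial in $n$ if there is $p\in\mathbb C[x]$ with $\gamma_n=p(n)$ for all $n\in\mathbb Z_+$. *)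

theory Defs
  imports "HOL-Analysis.Inner_Product" "HOL-Computational_Algebra.Polynomial"
begin

section \<open>Complex inner product spaces\<close>

text \<open>The distribution only provides real inner product spaces. A complex inner product space is
  rendered as a complex vector space with a sesquilinear, Hermitian form whose real part is the real
  inner product (and hence also determines the library norm). Every complex inner product space
  carries this real structure in exactly one way, so no generality is lost; in particular,
  completeness is not assumed. As a convention, the form is linear in its first argument.\<close>

class complex_vector = ab_group_add +
  fixes scaleC :: "complex \<Rightarrow> 'a \<Rightarrow> 'a"  (infixr "*\<^sub>C" 75)
  assumes scaleC_add_right: "a *\<^sub>C (x + y) = a *\<^sub>C x + a *\<^sub>C y"
    and scaleC_add_left: "(a + b) *\<^sub>C x = a *\<^sub>C x + b *\<^sub>C x"
    and scaleC_scaleC: "a *\<^sub>C b *\<^sub>C x = (a * b) *\<^sub>C x"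
    and scaleC_one: "1 *\<^sub>C x = x"

global_interpretation complex_vector: vector_space "scaleC :: complex \<Rightarrow> 'a \<Rightarrow> 'a::complex_vector"
  by unfold_locales
    (fact scaleC_add_right scaleC_add_left scaleC_scaleC scaleC_one)+

abbreviation csubspace :: "'a::complex_vector set \<Rightarrow> bool"
  where "csubspace \<equiv> complex_vector.subspace"

abbreviation clinear :: "('a::complex_vector \<Rightarrow> 'b::complex_vector) \<Rightarrow> bool"
  where "clinear \<equiv> Vector_Spaces.linear scaleC scaleC"

class complex_inner = complex_vector + real_inner +
  fixes cinner :: "'a \<Rightarrow> 'a \<Rightarrow> complex"
  assumes scaleR_scaleC: "r *\<^sub>R x = complex_of_real r *\<^sub>C x"
    and cinner_add_left: "cinner (x + y) z = cinner x z + cinner y z"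
    and cinner_scaleC_left: "cinner (a *\<^sub>C x) y = a * cinner x y"
    and cinner_commute: "cinner x y = cnj (cinner y x)"
    and inner_eq_Re_cinner: "inner x y = Re (cinner x y)"

text \<open>The form is positive definite, and the library norm is the norm it induces.\<close>

lemma cinner_self_eq_norm: "cinner x x = complex_of_real ((norm x)\<^sup>2)"
  for x :: "'a::complex_inner"
proof -
  have "Im (cinner x x) = - Im (cinner x x)"
    by (metis cinner_commute cnj.simps(2))
  then show ?thesis
    by (simp add: complex_eq_iff power2_norm_eq_inner inner_eq_Re_cinner)
qed

lemma cinner_self_eq_0_iff: "cinner x x = 0 \<longleftrightarrow> x = 0"
  for x :: "'a::complex_inner"
  by (simp add: cinner_self_eq_norm)


section \<open>Linear operators\<close>

text \<open>The predicates below that do not mention linearity are only meant for linear operators.\<close>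

definition poly_op :: "complex poly \<Rightarrow> ('a::complex_vector \<Rightarrow> 'a) \<Rightarrow> 'a \<Rightarrow> 'a"
  where "poly_op p S = (\<lambda>h. \<Sum>i\<le>degree p. coeff p i *\<^sub>C (S ^^ i) h)"

definition algebraic_op :: "('a::complex_vector \<Rightarrow> 'a) \<Rightarrow> bool"
  where "algebraic_op S \<longleftrightarrow> (\<exists>p. p \<noteq> 0 \<and> poly_op p S = (\<lambda>h. 0))"

definition m_isometry :: "nat \<Rightarrow> ('a::complex_inner \<Rightarrow> 'a) \<Rightarrow> bool"
  where "m_isometry m S \<longleftrightarrow> m \<ge> 1 \<and>
    (\<forall>h. (\<Sum>k\<le>m. (- 1) ^ k * real (m choose k) * (norm ((S ^^ k) h))\<^sup>2) = 0)"

definition strict_m_isometry :: "nat \<Rightarrow> ('a::complex_inner \<Rightarrow> 'a) \<Rightarrow> bool"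
  where "strict_m_isometry m S \<longleftrightarrow> m_isometry m S \<and>
    (m = 1 \<and> (UNIV :: 'a set) \<noteq> {0} \<or> m \<ge> 2 \<and> \<not> m_isometry (m - 1) S)"

definition isometric_op :: "('a::complex_inner \<Rightarrow> 'a) \<Rightarrow> bool"
  where "isometric_op V \<longleftrightarrow> clinear V \<and> (\<forall>h. norm (V h) = norm h)"

definition unitary_op :: "('a::complex_inner \<Rightarrow> 'a) \<Rightarrow> bool"
  where "unitary_op V \<longleftrightarrow> isometric_op V \<and> surj V"

definition polynomial_seq :: "(nat \<Rightarrow> complex) \<Rightarrow> bool"
  where "polynomial_seq \<gamma> \<longleftrightarrow> (\<exists>p :: complex poly. \<forall>n. \<gamma> n = poly p (of_nat n))"

text \<open>Operators on a subspace \<open>M\<close> are represented by functions on the whole type, of which only the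
  values on \<open>M\<close> matter.\<close>

definition clinear_on :: "'a::complex_vector set \<Rightarrow> ('a \<Rightarrow> 'a) \<Rightarrow> bool"
  where "clinear_on M S \<longleftrightarrow> S ` M \<subseteq> M \<and>
    (\<forall>x\<in>M. \<forall>y\<in>M. S (x + y) = S x + S y) \<and>
    (\<forall>c. \<forall>x\<in>M. S (c *\<^sub>C x) = c *\<^sub>C S x)"

definition nilpotent_on :: "'a::complex_vector set \<Rightarrow> ('a \<Rightarrow> 'a) \<Rightarrow> bool"
  where "nilpotent_on M N \<longleftrightarrow> (\<exists>k\<ge>1. \<forall>h\<in>M. (N ^^ k) h = 0)"

text \<open>Meaningful for a nilpotent operator on a nonzero subspace, where such a \<open>k\<close> exists and is
  unique.\<close>

definition nilpotency_index_on :: "'a::complex_vector set \<Rightarrow> ('a \<Rightarrow> 'a) \<Rightarrow> nat"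
  where "nilpotency_index_on M N =
    (THE k. k \<ge> 1 \<and> (\<forall>h\<in>M. (N ^^ k) h = 0) \<and> (\<exists>h\<in>M. (N ^^ (k - 1)) h \<noteq> 0))"

definition orthogonal_decomposition :: "nat \<Rightarrow> (nat \<Rightarrow> 'a::complex_inner set) \<Rightarrow> bool"
  where "orthogonal_decomposition \<kappa> M \<longleftrightarrow>
    (\<forall>j\<in>{1..\<kappa>}. csubspace (M j)) \<and>
    (\<forall>i\<in>{1..\<kappa>}. \<forall>j\<in>{1..\<kappa>}. i \<noteq> j \<longrightarrow> (\<forall>x\<in>M i. \<forall>y\<in>M j. cinner x y = 0)) \<and>
    (\<forall>h. \<exists>g. (\<forall>j\<in>{1..\<kappa>}. g j \<in> M j) \<and> h = (\<Sum>j=1..\<kappa>. g j))"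

text \<open>\<open>T = (z\<^sub>1 I + N\<^sub>1) \<oplus> \<dots> \<oplus> (z\<^sub>\<kappa> I + N\<^sub>\<kappa>)\<close> with respect to a nontrivial orthogonal decomposition
  \<open>M\<^sub>1, \<dots>, M\<^sub>\<kappa>\<close> of the whole space.\<close>

definition unimodular_nilpotent_decomposition ::
    "('a::complex_inner \<Rightarrow> 'a) \<Rightarrow> nat \<Rightarrow> (nat \<Rightarrow> complex) \<Rightarrow> (nat \<Rightarrow> 'a set) \<Rightarrow> (nat \<Rightarrow> 'a \<Rightarrow> 'a) \<Rightarrow> bool"
  where "unimodular_nilpotent_decomposition T \<kappa> z M N \<longleftrightarrow>
    \<kappa> \<ge> 1 \<and> orthogonal_decomposition \<kappa> M \<and> inj_on z {1..\<kappa>} \<and>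
    (\<forall>j\<in>{1..\<kappa>}. M j \<noteq> {0} \<and> T ` M j \<subseteq> M j \<and> cmod (z j) = 1 \<and>
      clinear_on (M j) (N j) \<and> nilpotent_on (M j) (N j) \<and>
      (\<forall>h\<in>M j. T h = z j *\<^sub>C h + N j h))"

end

theory Submission
  imports Defs "HOL-Computational_Algebra.Fundamental_Theorem_Algebra"
    "HOL-Computational_Algebra.Field_as_Ring" "HOL-Computational_Algebra.Polynomial_Factorial"
begin

text \<open>An algebraic operator splits the space into generalized eigenspaces. If the sequences
  \<open>\<parallel>T\<^sup>n h\<parallel>\<^sup>2\<close> are polynomial, so are the sequences \<open>\<langle>T\<^sup>n x, T\<^sup>n y\<rangle>\<close>, by polarization. A polynomial
  sequence that is geometric has ratio 1 or vanishes; for eigenvectors this puts the eigenvalues on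
  the unit circle, and for generalized eigenvectors to different eigenvalues it gives orthogonality,
  by induction on their heights. So \<open>V\<close> can be taken to be \<open>z\<^sub>j\<close> on the \<open>j\<close>-th generalized eigenspace.
  Conversely, if \<open>T = V + N\<close> with \<open>V\<close> isometric and \<open>VN = NV\<close>, then
  \<open>\<langle>Tx, Ty\<rangle> - \<langle>x, y\<rangle> = \<langle>Vx, Ny\<rangle> + \<langle>Nx, Ty\<rangle>\<close>, so the \<open>n\<close>-th forward difference of \<open>\<langle>T\<^sup>k x, T\<^sup>k y\<rangle>\<close> at
  \<open>k = 0\<close> is a binomial sum of the terms \<open>\<langle>N\<^sup>i V\<^sup>n\<^sup>-\<^sup>i x, N\<^sup>n\<^sup>-\<^sup>i T\<^sup>i y\<rangle>\<close>. If \<open>N\<close> has index \<open>K\<close>, all terms vanish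
  for \<open>n = 2K - 1\<close>, while for \<open>n = 2K - 2\<close> and \<open>x = y = h\<close> only a nonzero multiple of \<open>\<parallel>N\<^sup>K\<^sup>-\<^sup>1 h\<parallel>\<^sup>2\<close> is left.\<close>

section \<open>Linear operators and their polynomials\<close>

lemma funpow_commute_pointwise:
  assumes "\<And>x. f (g x) = g (f x)"
  shows "(f ^^ n) (g x) = g ((f ^^ n) x)"
  by (induction n) (simp_all add: assms)

lemma funpow_funpow_commute:
  assumes "\<And>x. f (g x) = g (f x)"
  shows "(f ^^ m) ((g ^^ n) x) = (g ^^ n) ((f ^^ m) x)"
proof (rule funpow_commute_pointwise)
  show "f ((g ^^ n) x) = (g ^^ n) (f x)" for x
    by (rule funpow_commute_pointwise[symmetric]) (simp add: assms)
qed

lemma clinear_iff: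
  "clinear f \<longleftrightarrow> (\<forall>x y. f (x + y) = f x + f y) \<and> (\<forall>c x. f (c *\<^sub>C x) = c *\<^sub>C f x)"
  by (simp add: Vector_Spaces.linear_iff complex_vector.vector_space_axioms)

lemma clinear_add: "clinear f \<Longrightarrow> f (x + y) = f x + f y"
  and clinear_scaleC: "clinear f \<Longrightarrow> f (c *\<^sub>C x) = c *\<^sub>C f x"
  by (simp_all add: clinear_iff)

lemma clinear_0: "clinear f \<Longrightarrow> f 0 = 0"
  using clinear_scaleC[of f 0 0] by simp

lemma clinear_diff: "clinear f \<Longrightarrow> f (x - y) = f x - f y"
  by (metis add_diff_cancel_right' clinear_add diff_add_cancel)

lemma clinear_sum: "clinear f \<Longrightarrow> f (\<Sum>i\<in>A. g i) = (\<Sum>i\<in>A. f (g i))"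
  by (induction A rule: infinite_finite_induct) (simp_all add: clinear_add clinear_0)

lemma clinear_funpow: "clinear f \<Longrightarrow> clinear (f ^^ n)"
  for f :: "'a::complex_vector \<Rightarrow> 'a"
  unfolding clinear_iff by (induction n) simp_all

lemma funpow_zero_mono:
  fixes f :: "'a::zero \<Rightarrow> 'a"
  assumes "f 0 = 0" "(f ^^ k) x = 0" "k \<le> n"
  shows "(f ^^ n) x = 0"
proof -
  have "(f ^^ i) 0 = 0" for i
    by (induction i) (simp_all add: assms(1))
  then show ?thesis
    using assms(2,3) by (metis comp_apply funpow_add le_add_diff_inverse2)
qed

section \<open>Polynomials evaluated at an operator\<close>

lemma poly_op_eq_sum:
  assumes "degree p \<le> d"
  shows "poly_op p S h = (\<Sum>i\<le>d. coeff p i *\<^sub>C (S ^^ i) h)"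
  unfolding poly_op_def using assms
  by (intro sum.mono_neutral_left) (auto simp: coeff_eq_0)

text \<open>Horner's scheme: it makes induction along \<open>pCons\<close> available for operator
  polynomials.\<close>

lemma poly_op_pCons: "poly_op (pCons a p) S h = a *\<^sub>C h + poly_op p S (S h)"
proof -
  have "poly_op (pCons a p) S h = (\<Sum>i\<le>Suc (degree p). coeff (pCons a p) i *\<^sub>C (S ^^ i) h)"
    by (rule poly_op_eq_sum) (rule degree_pCons_le)
  also have "\<dots> = a *\<^sub>C h + (\<Sum>i\<le>degree p. coeff p i *\<^sub>C (S ^^ i) (S h))"
    by (subst sum.atMost_Suc_shift) (simp add: funpow_swap1)
  finally show ?thesis
    by (simp add: poly_op_def)
qed

lemma poly_op_0 [simp]: "poly_op 0 S h = 0"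
  by (simp add: poly_op_def)

lemma poly_op_1 [simp]: "poly_op 1 S h = h"
  by (simp add: poly_op_def)

lemma poly_op_add: "poly_op (p + q) S h = poly_op p S h + poly_op q S h"
  by (simp add: poly_op_eq_sum[of _ "max (degree p) (degree q)"] degree_add_le
      complex_vector.scale_left_distrib sum.distrib)

lemma poly_op_smult: "poly_op (smult a p) S h = a *\<^sub>C poly_op p S h"
  by (simp add: poly_op_eq_sum[of _ "degree p"] degree_smult_le
      complex_vector.scale_sum_right)

lemma clinear_poly_op: "clinear S \<Longrightarrow> clinear (poly_op p S)"
  by (simp only: clinear_iff[of "poly_op p S"])
    (simp add: poly_op_def clinear_add[OF clinear_funpow]
      clinear_scaleC[OF clinear_funpow] complex_vector.scale_right_distrib sum.distrib
      complex_vector.scale_sum_right mult.commute)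

lemma poly_op_mult:
  assumes "clinear S"
  shows "poly_op (p * q) S h = poly_op p S (poly_op q S h)"
proof (induction p arbitrary: h)
  case (pCons a p)
  have "poly_op q S (S h) = S (poly_op q S h)"
    by (simp add: poly_op_def clinear_sum[OF assms] clinear_scaleC[OF assms] funpow_swap1)
  then show ?case
    by (simp add: poly_op_add poly_op_smult poly_op_pCons pCons.IH)
qed simp

text \<open>Kernels of powers of linear factors are thereby generalized eigenspaces; this is the
  bridge between polynomials and decompositions.\<close>

lemma poly_op_linear_power:
  assumes "clinear S"
  shows "poly_op ([:- z, 1:] ^ k) S h = ((\<lambda>x. S x - z *\<^sub>C x) ^^ k) h"
  by (induction k)
    (simp_all add: poly_op_mult[OF assms] poly_op_pCons del: mult_pCons_left)

lemma clinear_shift: "clinear S \<Longrightarrow> clinear (\<lambda>x. S x - z *\<^sub>C x)"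
  by (simp add: clinear_iff algebra_simps)

text \<open>Induction on the set of roots. A Bezout identity \<open>a * p + b * q = 1\<close> for
  the new factor \<open>p\<close> and the product \<open>q\<close> of the old ones splits
  \<open>h\<close> into a vector killed by \<open>p\<close> and a vector killed by \<open>q\<close>;
  the induction hypothesis splits the latter.\<close>

lemma primary_decomposition:
  assumes S: "clinear S" and "finite Z"
    and "poly_op (\<Prod>z\<in>Z. [:- z, 1:] ^ k z) S h = 0"
  obtains g where "h = (\<Sum>z\<in>Z. g z)"
    and "\<And>z. z \<in> Z \<Longrightarrow> ((\<lambda>x. S x - z *\<^sub>C x) ^^ k z) (g z) = 0"
proof -
  have "\<exists>g. h = (\<Sum>z\<in>Z. g z) \<and> (\<forall>z\<in>Z. poly_op ([:- z, 1:] ^ k z) S (g z) = 0)"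
    using assms(2,3)
  proof (induction Z arbitrary: h)
    case empty
    then show ?case by simp
  next
    case (insert w Z)
    define p where "p = [:- w, 1:] ^ k w"
    define q where "q = (\<Prod>z\<in>Z. [:- z, 1:] ^ k z)"
    \<comment> \<open>A common divisor of the two factors divides their difference, a nonzero
      constant.\<close>
    have "coprime [:- w, 1:] [:- z, 1:]" if "z \<in> Z" for z
    proof (rule coprimeI)
      fix c assume "c dvd [:- w, 1:]" "c dvd [:- z, 1:]"
      then have "c dvd [:- w, 1:] - [:- z, 1:]"
        by (rule dvd_diff)
      moreover have "z - w \<noteq> 0"
        using that insert.hyps by auto
      moreover have "[:- w, 1:] - [:- z, 1:] = [:z - w:]"
        by simp
      ultimately show "c dvd 1"
        by (metis dvd_trans is_unit_pCons_iff)
    qed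
    then have "coprime p q"
      unfolding p_def q_def by (intro prod_coprime_right) simp
    then obtain a b where ab: "a * p + b * q = 1"
      using bezout_coefficients[of p q] by (metis coprime_iff_gcd_eq_1 surj_pair)
    have pq: "poly_op (p * q) S h = 0"
      using insert by (simp add: p_def q_def)
    \<comment> \<open>Used with the Bezout coefficients \<open>a\<close> and \<open>b\<close> in
      place of \<open>r\<close>.\<close>
    have kill: "poly_op (r * (p * q)) S h = 0" for r
      by (simp only: poly_op_mult[OF S, of r] pq clinear_0[OF clinear_poly_op[OF S]])
    have in_ker: "poly_op q S (poly_op (a * p) S h) = 0" "poly_op p S (poly_op (b * q) S h) = 0"
      using kill[of a] kill[of b] by (simp_all only: poly_op_mult[OF S, symmetric] mult_ac)
    then obtain g where g: "poly_op (a * p) S h = (\<Sum>z\<in>Z. g z)"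
      "\<forall>z\<in>Z. poly_op ([:- z, 1:] ^ k z) S (g z) = 0"
      using insert.IH[of "poly_op (a * p) S h"] unfolding q_def by blast
    have "h = poly_op (b * q) S h + poly_op (a * p) S h"
      using ab by (metis poly_op_1 poly_op_add add.commute)
    moreover have "(\<Sum>z\<in>Z. (g(w := poly_op (b * q) S h)) z) = (\<Sum>z\<in>Z. g z)"
      using insert.hyps by (intro sum.cong) auto
    ultimately have "h = (\<Sum>z\<in>insert w Z. (g(w := poly_op (b * q) S h)) z)"
      using insert.hyps g(1) by simp
    moreover have "\<forall>z\<in>insert w Z. poly_op ([:- z, 1:] ^ k z) S ((g(w := poly_op (b * q) S h)) z) = 0"
      using g(2) in_ker(2) unfolding p_def by simp
    ultimately show ?case
      by blast
  qed
  then show ?thesis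
    using that unfolding poly_op_linear_power[OF S] by blast
qed

text \<open>Over the complex numbers an annihilating polynomial is its nonzero leading coefficient
  times a product of powers of linear factors, so the previous decomposition applies with root
  multiplicities as exponents.\<close>

lemma algebraic_op_primary_decomposition:
  assumes "clinear S" "algebraic_op S"
  obtains Z k where "finite Z" "\<And>h. \<exists>g. h = (\<Sum>z\<in>Z. g z) \<and>
    (\<forall>z\<in>Z. ((\<lambda>x. S x - z *\<^sub>C x) ^^ k z) (g z) = 0)"
proof -
  obtain p where p: "p \<noteq> 0" "poly_op p S = (\<lambda>h. 0)"
    using assms(2) by (auto simp: algebraic_op_def)
  define Z where "Z = {z. poly p z = 0}"
  have fin: "finite Z"
    unfolding Z_def using p(1) by (rule poly_roots_finite)
  have "poly_op (\<Prod>z\<in>Z. [:- z, 1:] ^ order z p) S h = 0" for h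
  proof -
    have "lead_coeff p *\<^sub>C poly_op (\<Prod>z\<in>Z. [:- z, 1:] ^ order z p) S h = 0"
      using fun_cong[OF p(2), of h] unfolding Z_def poly_op_smult[symmetric] complex_poly_decompose .
    then show ?thesis
      using p(1) by simp
  qed
  then have "\<exists>g. h = (\<Sum>z\<in>Z. g z) \<and>
      (\<forall>z\<in>Z. ((\<lambda>x. S x - z *\<^sub>C x) ^^ order z p) (g z) = 0)" for h
    by (rule primary_decomposition[OF assms(1) fin]) blast
  then show ?thesis
    by (rule that[OF fin])
qed

text \<open>The product of all linear factor powers kills each summand, since the factor belonging
  to that summand can be applied first.\<close>

lemma algebraic_op_if_primary_decomposition:
  assumes S: "clinear S" and "finite Z" and "\<And>h. \<exists>g. h = (\<Sum>z\<in>Z. g z) \<and>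
    (\<forall>z\<in>Z. ((\<lambda>x. S x - z *\<^sub>C x) ^^ k z) (g z) = 0)"
  shows "algebraic_op S"
proof -
  define p where "p = (\<Prod>z\<in>Z. [:- z, 1:] ^ k z)"
  have "p \<noteq> 0"
    using \<open>finite Z\<close> by (simp add: p_def)
  moreover have "poly_op p S h = 0" for h
  proof -
    obtain g where g: "h = (\<Sum>z\<in>Z. g z)"
      "\<forall>z\<in>Z. ((\<lambda>x. S x - z *\<^sub>C x) ^^ k z) (g z) = 0"
      using assms(3) by blast
    have "poly_op p S (g z) = 0" if "z \<in> Z" for z
    proof -
      have "p = (\<Prod>w\<in>Z - {z}. [:- w, 1:] ^ k w) * [:- z, 1:] ^ k z"
        unfolding p_def using that \<open>finite Z\<close> by (simp add: prod.remove mult.commute)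
      then show ?thesis
        using g(2) that
        by (simp add: poly_op_mult[OF S] poly_op_linear_power[OF S] clinear_0[OF clinear_poly_op[OF S]])
    qed
    then show ?thesis
      by (simp add: g(1) clinear_sum[OF clinear_poly_op[OF S]])
  qed
  ultimately show ?thesis
    by (auto simp: algebraic_op_def)
qed

section \<open>Complex inner products\<close>

lemma cinner_add_right: "cinner x (y + z) = cinner x y + cinner x z"
  for x :: "'a::complex_inner"
  by (metis cinner_add_left cinner_commute complex_cnj_add)

lemma cinner_scaleC_right: "cinner x (a *\<^sub>C y) = cnj a * cinner x y"
  for x :: "'a::complex_inner"
  by (metis cinner_scaleC_left cinner_commute complex_cnj_mult)

lemma cinner_0_left [simp]: "cinner 0 y = 0"
  and cinner_0_right [simp]: "cinner x 0 = 0"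
  for x y :: "'a::complex_inner"
  using cinner_scaleC_left[of 0 0 y] cinner_scaleC_right[of x 0 0] by simp_all

lemma cinner_sum_left: "cinner (\<Sum>i\<in>A. f i) y = (\<Sum>i\<in>A. cinner (f i) y)"
  for y :: "'a::complex_inner"
  by (induction A rule: infinite_finite_induct) (simp_all add: cinner_add_left)

lemma cinner_sum_right: "cinner x (\<Sum>i\<in>A. f i) = (\<Sum>i\<in>A. cinner x (f i))"
  for x :: "'a::complex_inner"
  by (induction A rule: infinite_finite_induct) (simp_all add: cinner_add_right)

text \<open>The class relates the norm to real scalars only; the complex case is read off from the
  form.\<close>

lemma norm_scaleC: "norm (a *\<^sub>C x) = cmod a * norm x"
  for x :: "'a::complex_inner"
proof -
  have "complex_of_real ((norm (a *\<^sub>C x))\<^sup>2) = complex_of_real ((cmod a * norm x)\<^sup>2)"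
    unfolding cinner_self_eq_norm[symmetric] cinner_scaleC_left cinner_scaleC_right
    using complex_norm_square[of a]
    by (simp add: cinner_self_eq_norm power_mult_distrib mult.commute)
  then show ?thesis
    by (simp only: of_real_eq_iff power2_eq_iff_nonneg norm_ge_zero mult_nonneg_nonneg)
qed

text \<open>The real inner product recovers real parts, and the imaginary part of
  \<open>cinner x y\<close> is the real part of \<open>cinner x (\<i> *\<^sub>C y)\<close>, the form
  being conjugate linear in its second argument.\<close>

lemma cinner_polarization:
  "cinner x y = complex_of_real (((norm (x + y))\<^sup>2 - (norm x)\<^sup>2 - (norm y)\<^sup>2) / 2) +
    \<i> * complex_of_real (((norm (x + \<i> *\<^sub>C y))\<^sup>2 - (norm x)\<^sup>2 - (norm (\<i> *\<^sub>C y))\<^sup>2) / 2)"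
  for x y :: "'a::complex_inner"
proof -
  have "Re (cinner x v) = ((norm (x + v))\<^sup>2 - (norm x)\<^sup>2 - (norm v)\<^sup>2) / 2" for v
    using dot_norm[of x v] by (simp add: inner_eq_Re_cinner)
  from this[of y] this[of "\<i> *\<^sub>C y"] show ?thesis
    by (simp add: complex_eq_iff cinner_scaleC_right)
qed

lemma isometric_op_cinner:
  assumes "isometric_op V"
  shows "cinner (V x) (V y) = cinner x y"
proof -
  have V: "clinear V" "\<And>h. norm (V h) = norm h"
    using assms by (auto simp: isometric_op_def)
  have "norm (V x + V y) = norm (x + y)" "norm (V x + \<i> *\<^sub>C V y) = norm (x + \<i> *\<^sub>C y)"
    "norm (\<i> *\<^sub>C V y) = norm (\<i> *\<^sub>C y)"
    by (simp_all add: V(2) flip: clinear_add[OF V(1)] clinear_scaleC[OF V(1)])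
  then show ?thesis
    by (simp add: cinner_polarization[of "V x"] cinner_polarization[of x] V(2))
qed

section \<open>Defects of iterated isometry\<close>

text \<open>Pascal's rule in summed form; it drives all inductions on the order of differences
  below.\<close>

lemma sum_binomial_Suc:
  fixes g :: "nat \<Rightarrow> 'b::comm_semiring_1"
  shows "(\<Sum>k\<le>Suc n. of_nat (Suc n choose k) * g k) =
    (\<Sum>k\<le>n. of_nat (n choose k) * (g k + g (Suc k)))"
proof -
  have "(\<Sum>k\<le>Suc n. of_nat (Suc n choose k) * g k) =
      g 0 + (\<Sum>k\<le>n. of_nat (n choose Suc k) * g (Suc k)) + (\<Sum>k\<le>n. of_nat (n choose k) * g (Suc k))"
    by (subst sum.atMost_Suc_shift) (simp add: algebra_simps sum.distrib)
  also have "g 0 + (\<Sum>k\<le>n. of_nat (n choose Suc k) * g (Suc k)) = (\<Sum>k\<le>Suc n. of_nat (n choose k) * g k)"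
    by (subst sum.atMost_Suc_shift) simp
  finally show ?thesis
    by (simp add: algebra_simps sum.distrib binomial_eq_0)
qed

text \<open>The \<open>m\<close>-th forward difference of \<open>k \<mapsto> \<langle>T\<^sup>k x, T\<^sup>k y\<rangle>\<close> at \<open>k = 0\<close>.\<close>

definition isometry_defect :: "nat \<Rightarrow> ('a::complex_inner \<Rightarrow> 'a) \<Rightarrow> 'a \<Rightarrow> 'a \<Rightarrow> complex"
  where "isometry_defect m T x y =
    (\<Sum>k\<le>m. of_nat (m choose k) * ((- 1) ^ (m - k) * cinner ((T ^^ k) x) ((T ^^ k) y)))"

lemma isometry_defect_0 [simp]: "isometry_defect 0 T x y = cinner x y"
  by (simp add: isometry_defect_def)

lemma isometry_defect_Suc:
  "isometry_defect (Suc m) T x y = isometry_defect m T (T x) (T y) - isometry_defect m T x y"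
proof -
  have "(- 1) ^ (Suc m - k) = - ((- 1 :: complex) ^ (m - k))" if "k \<in> {..m}" for k
    using that by (simp add: Suc_diff_le)
  moreover have "(T ^^ Suc k) z = (T ^^ k) (T z)" for k z
    by (simp add: funpow_swap1)
  ultimately show ?thesis
    unfolding isometry_defect_def sum_binomial_Suc sum_subtractf[symmetric]
    by (intro sum.cong) (simp_all add: right_diff_distrib del: funpow.simps)
qed

text \<open>The signs of the two sums differ by the global factor \<open>(- 1) ^ m\<close>.\<close>

lemma m_isometry_iff_defect:
  "m_isometry m T \<longleftrightarrow> m \<ge> 1 \<and> (\<forall>h. isometry_defect m T h h = 0)"
proof -
  have "isometry_defect m T h h = (- 1) ^ m * complex_of_real
      (\<Sum>k\<le>m. (- 1) ^ k * real (m choose k) * (norm ((T ^^ k) h))\<^sup>2)" for h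
    unfolding isometry_defect_def of_real_sum sum_distrib_left
  proof (intro sum.cong refl)
    fix k assume "k \<in> {..m}"
    then have "(- 1 :: complex) ^ (m - k) = (- 1) ^ m * (- 1) ^ k"
      by (auto simp: minus_one_power_iff)
    then show "of_nat (m choose k) * ((- 1) ^ (m - k) * cinner ((T ^^ k) h) ((T ^^ k) h)) =
      (- 1) ^ m * complex_of_real ((- 1) ^ k * real (m choose k) * (norm ((T ^^ k) h))\<^sup>2)"
      by (simp add: cinner_self_eq_norm mult_ac)
  qed
  then show ?thesis
    by (simp add: m_isometry_def del: of_real_sum of_real_mult)
qed

text \<open>Newton's forward difference formula.\<close>

lemma cinner_funpow_eq_sum_defect:
  "cinner ((T ^^ n) x) ((T ^^ n) y) = (\<Sum>k\<le>n. of_nat (n choose k) * isometry_defect k T x y)"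
proof (induction n arbitrary: x y)
  case (Suc n)
  have "cinner ((T ^^ Suc n) x) ((T ^^ Suc n) y) =
      (\<Sum>k\<le>n. of_nat (n choose k) * isometry_defect k T (T x) (T y))"
    using Suc.IH[of "T x" "T y"] by (simp add: funpow_swap1)
  then show ?case
    unfolding sum_binomial_Suc by (simp add: isometry_defect_Suc)
qed simp

text \<open>One difference step replaces each inner product by two: since \<open>V\<close> preserves
  the form, the \<open>V\<close>-\<open>V\<close> term cancels. Commutation moves the new operators
  into the existing powers, and Pascal's rule collects the terms.\<close>

lemma isometry_defect_isometric_add:
  assumes T: "T = (\<lambda>h. V h + N h)" and V: "isometric_op V" and N: "clinear N"
    and comm: "V \<circ> N = N \<circ> V"
  shows "isometry_defect n T x y =
    (\<Sum>i\<le>n. of_nat (n choose i) *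
      cinner ((N ^^ i) ((V ^^ (n - i)) x)) ((N ^^ (n - i)) ((T ^^ i) y)))"
proof (induction n arbitrary: x y)
  case (Suc n)
  have Vlin: "clinear V"
    using V by (simp add: isometric_op_def)
  have VN: "V (N x) = N (V x)" for x
    using comm by (metis comp_apply)
  have NT: "N (T x) = T (N x)" for x
    by (simp add: T VN clinear_add[OF N])
  have VT: "V (T x) = T (V x)" for x
    by (simp add: T VN clinear_add[OF Vlin])
  have eqs: "(V ^^ j) (T x) = T ((V ^^ j) x)" "(N ^^ j) (T x) = T ((N ^^ j) x)"
    "(N ^^ j) (V x) = V ((N ^^ j) x)" "(T ^^ j) (T x) = T ((T ^^ j) x)" for j x
    by (rule funpow_commute_pointwise, rule VT NT VN[symmetric] refl)+
  have step: "cinner (T u) (T v) - cinner u v = cinner (V u) (N v) + cinner (N u) (T v)" for u v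
    by (simp add: T cinner_add_left cinner_add_right isometric_op_cinner[OF V])
  have "isometry_defect (Suc n) T x y = (\<Sum>i\<le>n. of_nat (n choose i) *
      (cinner ((N ^^ i) ((V ^^ (n - i)) (T x))) ((N ^^ (n - i)) ((T ^^ i) (T y)))
       - cinner ((N ^^ i) ((V ^^ (n - i)) x)) ((N ^^ (n - i)) ((T ^^ i) y))))"
    by (simp add: isometry_defect_Suc Suc.IH sum_subtractf[symmetric] right_diff_distrib)
  \<comment> \<open>The first new term adds a \<open>V\<close> on the left and an \<open>N\<close>
    on the right, so \<open>i\<close> stays; the second adds an \<open>N\<close> on the left and a
    \<open>T\<close> on the right, so \<open>i\<close> grows by one.\<close>
  also have "\<dots> = (\<Sum>i\<le>n. of_nat (n choose i) *
      (cinner ((N ^^ i) ((V ^^ (Suc n - i)) x)) ((N ^^ (Suc n - i)) ((T ^^ i) y))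
       + cinner ((N ^^ Suc i) ((V ^^ (Suc n - Suc i)) x)) ((N ^^ (Suc n - Suc i)) ((T ^^ Suc i) y))))"
  proof (intro sum.cong refl arg_cong2[where f = times])
    fix i assume "i \<in> {..n}"
    then have i: "Suc n - i = Suc (n - i)"
      by (simp add: Suc_diff_le)
    show "cinner ((N ^^ i) ((V ^^ (n - i)) (T x))) ((N ^^ (n - i)) ((T ^^ i) (T y)))
       - cinner ((N ^^ i) ((V ^^ (n - i)) x)) ((N ^^ (n - i)) ((T ^^ i) y)) =
      cinner ((N ^^ i) ((V ^^ (Suc n - i)) x)) ((N ^^ (Suc n - i)) ((T ^^ i) y))
       + cinner ((N ^^ Suc i) ((V ^^ (Suc n - Suc i)) x)) ((N ^^ (Suc n - Suc i)) ((T ^^ Suc i) y))"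
      by (simp only: i diff_Suc_Suc funpow.simps o_apply eqs step)
  qed
  finally show ?case
    unfolding sum_binomial_Suc .
qed simp

text \<open>In each term of the defect the two exponents of \<open>N\<close> add up to
  \<open>2 * K - 1\<close>, so one of them is at least \<open>K\<close>.\<close>

lemma m_isometry_isometric_add_nilpotent:
  assumes T: "T = (\<lambda>h. V h + N h)" and V: "isometric_op V" and N: "clinear N"
    and comm: "V \<circ> N = N \<circ> V" and K: "K \<ge> 1" "\<And>h. (N ^^ K) h = 0"
  shows "m_isometry (2 * K - 1) T"
proof -
  have zero: "(N ^^ i) h = 0" if "K \<le> i" for i h
    using funpow_zero_mono[OF clinear_0[OF N] K(2) that] .
  have "cinner ((N ^^ i) u) ((N ^^ (2 * K - 1 - i)) v) = 0" for i u v
  proof (cases "K \<le> i")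
    case False
    then have "K \<le> 2 * K - 1 - i"
      by linarith
    then show ?thesis
      by (simp add: zero)
  qed (simp add: zero)
  then show ?thesis
    using K(1) by (simp add: m_isometry_iff_defect isometry_defect_isometric_add[OF T V N comm])
qed

text \<open>One order lower, the exponents of \<open>N\<close> add up to \<open>2 * (K - 1)\<close>,
  and only the term with both equal to \<open>K - 1\<close> survives.\<close>

lemma strict_m_isometry_isometric_add_nilpotent:
  fixes T :: "'a::complex_inner \<Rightarrow> 'a"
  assumes T: "T = (\<lambda>h. V h + N h)" and V: "isometric_op V" and N: "clinear N"
    and comm: "V \<circ> N = N \<circ> V" and K: "K \<ge> 1" "\<And>h. (N ^^ K) h = 0"
    and h: "(N ^^ (K - 1)) h \<noteq> 0"
  shows "strict_m_isometry (2 * K - 1) T"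
proof -
  have iso: "m_isometry (2 * K - 1) T"
    using m_isometry_isometric_add_nilpotent[of T V N K] T V N comm K by blast
  have nontriv: "(UNIV :: 'a set) \<noteq> {0}"
    using h by blast
  show ?thesis
  \<comment> \<open>Here the order is 1, where strictness only asks for a nonzero space.\<close>
  proof (cases "K = 1")
    case True
    then show ?thesis
      using iso nontriv by (simp add: strict_m_isometry_def)
  next
    case False
    define L where "L = K - 1"
    have L: "K = Suc L" "L \<ge> 1"
      using K(1) False by (auto simp: L_def)
    have zero: "(N ^^ i) h = 0" if "L < i" for i h
      using funpow_zero_mono[OF clinear_0[OF N] K(2)] that L(1) by simp
    have VN: "V (N x) = N (V x)" for x
      using comm by (metis comp_apply)
    \<comment> \<open>\<open>N ^^ L\<close> kills the range of \<open>N\<close>, so behind it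
      \<open>T\<close> acts like \<open>V\<close>.\<close>
    have NT: "(N ^^ L) (T x) = V ((N ^^ L) x)" for x
      using zero[of "Suc L" x]
      by (simp add: T clinear_add[OF clinear_funpow[OF N]] funpow_commute_pointwise[where f = N and g = V, OF VN[symmetric]]
          funpow_swap1)
    have NTi: "(N ^^ L) ((T ^^ i) x) = (V ^^ i) ((N ^^ L) x)" for i x
      by (induction i) (simp_all add: NT)
    have NVi: "(N ^^ L) ((V ^^ i) x) = (V ^^ i) ((N ^^ L) x)" for i x
      by (rule funpow_funpow_commute) (simp add: VN)
    have normV: "norm ((V ^^ i) x) = norm x" for i x
      using V by (induction i) (auto simp: isometric_op_def)
    have "isometry_defect (2 * L) T h h = (\<Sum>i\<le>2 * L. of_nat (2 * L choose i) *
        cinner ((N ^^ i) ((V ^^ (2 * L - i)) h)) ((N ^^ (2 * L - i)) ((T ^^ i) h)))"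
      by (rule isometry_defect_isometric_add[OF T V N comm])
    also have "\<dots> = (\<Sum>i\<in>{L}. of_nat (2 * L choose i) *
        cinner ((N ^^ i) ((V ^^ (2 * L - i)) h)) ((N ^^ (2 * L - i)) ((T ^^ i) h)))"
    proof (intro sum.mono_neutral_right ballI)
      fix i assume "i \<in> {..2 * L} - {L}"
      then have "L < i \<or> L < 2 * L - i"
        by auto
      then show "of_nat (2 * L choose i) *
        cinner ((N ^^ i) ((V ^^ (2 * L - i)) h)) ((N ^^ (2 * L - i)) ((T ^^ i) h)) = 0"
        using zero by auto
    qed auto
    \<comment> \<open>Both arguments of the form equal \<open>(V ^^ L) ((N ^^ L) h)\<close>, and
      \<open>V\<close> preserves norms.\<close>
    also have "\<dots> = of_nat (2 * L choose L) * complex_of_real ((norm ((N ^^ L) h))\<^sup>2)"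
      by (simp add: NTi NVi cinner_self_eq_norm normV)
    also have "\<dots> \<noteq> 0"
      using h by (simp add: L_def)
    finally have "\<not> m_isometry (2 * K - 1 - 1) T"
      using L by (auto simp: m_isometry_iff_defect)
    then show ?thesis
      using iso L by (simp add: strict_m_isometry_def)
  qed
qed

section \<open>Polynomial sequences\<close>

lemma polynomial_seq_const: "polynomial_seq (\<lambda>n. c)"
  unfolding polynomial_seq_def by (rule exI[of _ "[:c:]"]) simp

lemma polynomial_seq_add:
  assumes "polynomial_seq a" "polynomial_seq b"
  shows "polynomial_seq (\<lambda>n. a n + b n)"
  using assms unfolding polynomial_seq_def by (metis poly_add)

lemma polynomial_seq_cmult:
  assumes "polynomial_seq a"
  shows "polynomial_seq (\<lambda>n. c * a n)"
  using assms unfolding polynomial_seq_def by (metis poly_smult)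

lemma polynomial_seq_sum:
  assumes "\<And>i. i \<in> A \<Longrightarrow> polynomial_seq (a i)"
  shows "polynomial_seq (\<lambda>n. \<Sum>i\<in>A. a i n)"
  using assms
  by (induction A rule: infinite_finite_induct) (simp_all add: polynomial_seq_const polynomial_seq_add)

text \<open>The witness is the falling factorial of degree \<open>k\<close> divided by
  \<open>fact k\<close>.\<close>

lemma polynomial_seq_binomial: "polynomial_seq (\<lambda>n. of_nat (n choose k))"
  unfolding polynomial_seq_def binomial_gbinomial gbinomial_prod_rev atLeast0LessThan
  by (rule exI[of _ "smult (inverse (fact k)) (\<Prod>i<k. [:- of_nat i, 1:])"])
    (simp add: poly_prod divide_inverse mult.commute)

text \<open>Comparing leading coefficients of \<open>p (x + 1)\<close> and \<open>c * p x\<close>.\<close>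

lemma polynomial_seq_geometric:
  assumes "polynomial_seq a" "\<And>n. a (Suc n) = c * a n" "c \<noteq> 1"
  shows "a n = 0"
proof -
  obtain p where p: "\<And>n. a n = poly p (of_nat n)"
    using assms(1) by (auto simp: polynomial_seq_def)
  have "poly (p \<circ>\<^sub>p [:1, 1:] - smult c p) (of_nat n) = 0" for n
    using assms(2)[of n] p[of "Suc n"] p[of n] by (simp add: poly_pcompose)
  \<comment> \<open>A polynomial vanishing at all natural numbers has infinitely many roots, hence
    is zero.\<close>
  then have "range of_nat \<subseteq> {x. poly (p \<circ>\<^sub>p [:1, 1:] - smult c p) x = 0}"
    by blast
  moreover have "infinite (range (of_nat :: nat \<Rightarrow> complex))"
    by (simp add: range_inj_infinite inj_of_nat)
  ultimately have "p \<circ>\<^sub>p [:1, 1:] - smult c p = 0"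
    using poly_roots_finite finite_subset by blast
  then have eq: "p \<circ>\<^sub>p [:1, 1:] = smult c p"
    by simp
  have "lead_coeff (p \<circ>\<^sub>p [:1, 1:]) = lead_coeff p"
    by (subst lead_coeff_comp) simp_all
  then have "lead_coeff p = c * lead_coeff p"
    by (simp only: eq lead_coeff_smult)
  then have "p = 0"
    using assms(3) by simp
  then show ?thesis
    by (simp add: p)
qed

text \<open>All differences of order at least \<open>m\<close> vanish, so Newton's formula stops at
  a length independent of \<open>n\<close>.\<close>

lemma polynomial_seq_norm_if_m_isometry:
  assumes "m_isometry m T"
  shows "polynomial_seq (\<lambda>n. complex_of_real ((norm ((T ^^ n) h))\<^sup>2))"
proof -
  have vanish: "isometry_defect k T x x = 0" if "m \<le> k" for k x
    using that
  proof (induction k arbitrary: x rule: dec_induct)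
    case base
    then show ?case
      using assms by (simp add: m_isometry_iff_defect)
  next
    case (step k)
    then show ?case
      by (simp add: isometry_defect_Suc)
  qed
  have "complex_of_real ((norm ((T ^^ n) h))\<^sup>2) =
      (\<Sum>k<m. of_nat (n choose k) * isometry_defect k T h h)" for n
  proof -
    have "complex_of_real ((norm ((T ^^ n) h))\<^sup>2) =
        (\<Sum>k\<le>n. of_nat (n choose k) * isometry_defect k T h h)"
      by (simp only: cinner_self_eq_norm[symmetric] cinner_funpow_eq_sum_defect)
    \<comment> \<open>Passing through the union avoids comparing \<open>n\<close> with
      \<open>m\<close>: binomials vanish beyond \<open>n\<close>, defects from \<open>m\<close>
      on.\<close>
    also have "\<dots> = (\<Sum>k\<in>{..n} \<union> {..<m}. of_nat (n choose k) * isometry_defect k T h h)"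
      by (rule sum.mono_neutral_left) (auto simp: binomial_eq_0)
    also have "\<dots> = (\<Sum>k<m. of_nat (n choose k) * isometry_defect k T h h)"
      by (rule sum.mono_neutral_right) (auto simp: vanish)
    finally show ?thesis .
  qed
  moreover have "polynomial_seq (\<lambda>n. \<Sum>k<m. of_nat (n choose k) * isometry_defect k T h h)"
    by (intro polynomial_seq_sum)
      (simp only: mult.commute[of "of_nat _"], intro polynomial_seq_cmult polynomial_seq_binomial)
  ultimately show ?thesis
    by simp
qed

lemma polynomial_seq_cinner:
  fixes T :: "'a::complex_inner \<Rightarrow> 'a"
  assumes T: "clinear T"
    and poly: "\<And>h. polynomial_seq (\<lambda>n. complex_of_real ((norm ((T ^^ n) h))\<^sup>2))"
  shows "polynomial_seq (\<lambda>n. cinner ((T ^^ n) x) ((T ^^ n) y))"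
proof -
  define a where "a h n = complex_of_real ((norm ((T ^^ n) h))\<^sup>2)" for h n
  have a: "polynomial_seq (a h)" for h
    unfolding a_def by (rule poly)
  have "cinner ((T ^^ n) x) ((T ^^ n) y) =
      1 / 2 * (a (x + y) n + (- 1) * a x n + (- 1) * a y n)
      + \<i> / 2 * (a (x + \<i> *\<^sub>C y) n + (- 1) * a x n + (- 1) * a (\<i> *\<^sub>C y) n)" for n
    by (simp add: cinner_polarization[of "(T ^^ n) x"] a_def clinear_add[OF clinear_funpow[OF T]]
        clinear_scaleC[OF clinear_funpow[OF T]])
  then show ?thesis
    by (simp only:) (intro polynomial_seq_add polynomial_seq_cmult a)
qed

section \<open>Generalized eigenspaces\<close>

text \<open>On an eigenvector the squared norms are geometric with ratio
  \<open>(cmod z)\<^sup>2\<close>; a ratio other than 1 would make them all vanish.\<close>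

lemma eigenvalue_unimodular:
  fixes T :: "'a::complex_inner \<Rightarrow> 'a"
  assumes T: "clinear T" and e: "T e = z *\<^sub>C e" "e \<noteq> 0"
    and poly: "polynomial_seq (\<lambda>n. complex_of_real ((norm ((T ^^ n) e))\<^sup>2))"
  shows "cmod z = 1"
proof (rule ccontr)
  assume "cmod z \<noteq> 1"
  then have "complex_of_real ((cmod z)\<^sup>2) \<noteq> 1"
    by (metis norm_ge_zero of_real_eq_1_iff power2_eq_1_iff neg_0_le_iff_le not_one_le_zero)
  moreover have "T ((T ^^ n) e) = z *\<^sub>C (T ^^ n) e" for n
    by (simp add: funpow_swap1 e(1) clinear_scaleC[OF clinear_funpow[OF T]])
  then have "complex_of_real ((norm ((T ^^ Suc n) e))\<^sup>2) =
      complex_of_real ((cmod z)\<^sup>2) * complex_of_real ((norm ((T ^^ n) e))\<^sup>2)" for n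
    by (simp add: norm_scaleC power_mult_distrib)
  ultimately have "complex_of_real ((norm ((T ^^ 0) e))\<^sup>2) = 0"
    by (intro polynomial_seq_geometric[OF poly])
  then show False
    using e(2) by simp
qed

text \<open>By induction on the heights, the sequence \<open>\<langle>T\<^sup>n x, T\<^sup>n y\<rangle>\<close> is geometric with ratio
  \<open>z * cnj w \<noteq> 1\<close>.\<close>

lemma generalized_eigenspaces_orthogonal:
  fixes T :: "'a::complex_inner \<Rightarrow> 'a"
  assumes T: "clinear T"
    and poly: "\<And>h. polynomial_seq (\<lambda>n. complex_of_real ((norm ((T ^^ n) h))\<^sup>2))"
    and "cmod w = 1" "z \<noteq> w"
    and "((\<lambda>v. T v - z *\<^sub>C v) ^^ a) x = 0" "((\<lambda>v. T v - w *\<^sub>C v) ^^ b) y = 0"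
  shows "cinner x y = 0"
  using assms(5,6)
proof (induction "a + b" arbitrary: a b x y rule: less_induct)
  case less
  define A where "A = (\<lambda>v. T v - z *\<^sub>C v)"
  define B where "B = (\<lambda>v. T v - w *\<^sub>C v)"
  note IH = less.hyps[folded A_def B_def] and prems = less.prems[folded A_def B_def]
  show ?case
  proof (cases "a = 0 \<or> b = 0")
    case True
    then show ?thesis
      using prems by auto
  next
    case False
    then obtain a' b' where ab: "a = Suc a'" "b = Suc b'"
      by (metis not0_implies_Suc)
    have commA: "(A ^^ i) ((T ^^ n) v) = (T ^^ n) ((A ^^ i) v)"
      and commB: "(B ^^ i) ((T ^^ n) v) = (T ^^ n) ((B ^^ i) v)" for i n v
      by (rule funpow_funpow_commute, simp add: A_def B_def clinear_diff[OF T] clinear_scaleC[OF T])+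
    have kerA: "(A ^^ a) ((T ^^ n) x) = 0" and kerB: "(B ^^ b) ((T ^^ n) y) = 0" for n
      by (simp_all add: commA commB prems clinear_0[OF clinear_funpow[OF T]] del: funpow.simps)
    have "cinner ((T ^^ Suc n) x) ((T ^^ Suc n) y) = (z * cnj w) * cinner ((T ^^ n) x) ((T ^^ n) y)" for n
    proof -
      have dec: "(T ^^ Suc n) x = z *\<^sub>C (T ^^ n) x + A ((T ^^ n) x)"
        "(T ^^ Suc n) y = w *\<^sub>C (T ^^ n) y + B ((T ^^ n) y)"
        by (simp_all add: A_def B_def)
      have "(A ^^ a') (A ((T ^^ n) x)) = 0" "(B ^^ b') (B ((T ^^ n) y)) = 0"
        using kerA[of n] kerB[of n] by (simp_all add: ab funpow_swap1)
      \<comment> \<open>\<open>A\<close> and \<open>B\<close> each lower a height by one, so all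
        terms but the leading one fall under the induction hypothesis.\<close>
      then have "cinner (A ((T ^^ n) x)) ((T ^^ n) y) = 0" "cinner (A ((T ^^ n) x)) (B ((T ^^ n) y)) = 0"
        "cinner ((T ^^ n) x) (B ((T ^^ n) y)) = 0"
        using IH[of a' b "A ((T ^^ n) x)" "(T ^^ n) y"] IH[of a' b' "A ((T ^^ n) x)" "B ((T ^^ n) y)"]
          IH[of a b' "(T ^^ n) x" "B ((T ^^ n) y)"] kerA[of n] kerB[of n] by (simp_all add: ab del: funpow.simps)
      then show ?thesis
        unfolding dec by (simp add: cinner_add_left cinner_add_right cinner_scaleC_left cinner_scaleC_right)
    qed
    moreover have "z * cnj w \<noteq> 1"
    proof
      \<comment> \<open>Multiplying by \<open>w\<close> and using \<open>cmod w = 1\<close> gives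
        \<open>z = w\<close>.\<close>
      assume "z * cnj w = 1"
      then have "z * (w * cnj w) = w"
        by (simp add: mult.left_commute)
      then show False
        using assms(3,4) by (simp add: complex_norm_square[symmetric])
    qed
    ultimately have "cinner ((T ^^ 0) x) ((T ^^ 0) y) = 0"
      by (intro polynomial_seq_geometric[OF polynomial_seq_cinner[OF T poly]])
    then show ?thesis
      by simp
  qed
qed

lemma unimodular_nilpotent_decomposition_exists:
  fixes T :: "'a::complex_inner \<Rightarrow> 'a"
  assumes nontriv: "(UNIV :: 'a set) \<noteq> {0}" and T: "clinear T" and alg: "algebraic_op T"
    and poly: "\<And>h. polynomial_seq (\<lambda>n. complex_of_real ((norm ((T ^^ n) h))\<^sup>2))"
  shows "\<exists>\<kappa> z M N. unimodular_nilpotent_decomposition T \<kappa> z M N"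
proof -
  define A where "A = (\<lambda>z v. T v - z *\<^sub>C v)"
  have A: "clinear (A z)" for z
    unfolding A_def by (rule clinear_shift[OF T])
  obtain Z k where Z: "finite Z" and dec: "\<And>h. \<exists>g. h = (\<Sum>z\<in>Z. g z) \<and> (\<forall>z\<in>Z. (A z ^^ k z) (g z) = 0)"
    using algebraic_op_primary_decomposition[OF T alg] unfolding A_def by metis
  define E where "E = (\<lambda>z. {h. (A z ^^ k z) h = 0})"
  have sub: "csubspace (E z)" for z
    unfolding E_def complex_vector.subspace_def
    by (simp add: clinear_0[OF clinear_funpow[OF A]] clinear_add[OF clinear_funpow[OF A]]
        clinear_scaleC[OF clinear_funpow[OF A]])
  have invA: "A z h \<in> E z" if "h \<in> E z" for z h
    using that by (simp add: E_def funpow_swap1[symmetric] clinear_0[OF A])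
  have invT: "T h \<in> E z" if "h \<in> E z" for z h
    using complex_vector.subspace_add[OF sub invA[OF that] complex_vector.subspace_scale[OF sub that, of z]]
    by (simp add: A_def)
  \<comment> \<open>The annihilating polynomial may have roots that are not eigenvalues; their
    trivial spaces are discarded.\<close>
  define Z' where "Z' = {z \<in> Z. E z \<noteq> {0}}"
  have Z': "finite Z'"
    using Z by (simp add: Z'_def)
  have unimod: "cmod z = 1" if "z \<in> Z'" for z
  proof -
    have "E z \<noteq> {0}" "0 \<in> E z"
      using that complex_vector.subspace_0[OF sub, of z] by (simp_all add: Z'_def)
    then obtain h where h: "(A z ^^ k z) h = 0" "h \<noteq> 0"
      unfolding E_def by blast
    \<comment> \<open>The last nonzero vector in the chain \<open>(A z ^^ i) h\<close> is an
      eigenvector.\<close>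
    define i where "i = (LEAST i. (A z ^^ i) h = 0)"
    have i: "(A z ^^ i) h = 0"
      unfolding i_def using h(1) by (rule LeastI)
    then obtain j where j: "i = Suc j"
      using h(2) by (cases i) auto
    then have "(A z ^^ j) h \<noteq> 0"
      using not_less_Least[of j "\<lambda>i. (A z ^^ i) h = 0"] by (simp add: i_def)
    moreover have "T ((A z ^^ j) h) = z *\<^sub>C (A z ^^ j) h"
      using i by (simp add: j A_def)
    ultimately show ?thesis
      using eigenvalue_unimodular[OF T _ _ poly] by blast
  qed
  \<comment> \<open>Exponent 0 would force \<open>E z = {0}\<close>; \<open>nilpotent_on\<close>
    asks for a positive exponent.\<close>
  have k: "k z \<ge> 1" if "z \<in> Z'" for z
    using that by (cases "k z") (auto simp: Z'_def E_def)
  have dec': "\<exists>g. (\<forall>z\<in>Z'. g z \<in> E z) \<and> h = (\<Sum>z\<in>Z'. g z)" for h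
  proof -
    obtain g where g: "h = (\<Sum>z\<in>Z. g z)" "\<forall>z\<in>Z. g z \<in> E z"
      using dec[of h] by (auto simp: E_def)
    have "(\<Sum>z\<in>Z. g z) = (\<Sum>z\<in>Z'. g z)"
      using g(2) Z by (intro sum.mono_neutral_right) (auto simp: Z'_def)
    then show ?thesis
      using g by (intro exI[of _ g]) (auto simp: Z'_def)
  qed
  obtain f where f: "bij_betw f {1..card Z'} Z'"
    using ex_bij_betw_nat_finite_1[OF Z'] by blast
  have fZ: "f j \<in> Z'" if "j \<in> {1..card Z'}" for j
    using f that by (rule bij_betwE[THEN bspec])
  have inj: "inj_on f {1..card Z'}"
    using f by (rule bij_betw_imp_inj_on)
  have "card Z' \<ge> 1"
  proof (rule ccontr)
    assume "\<not> card Z' \<ge> 1"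
    then have "Z' = {}"
      using Z' by (simp add: not_le)
    then have "h = 0" for h :: 'a
      using dec'[of h] by simp
    then show False
      using nontriv by auto
  qed
  moreover have "orthogonal_decomposition (card Z') (E \<circ> f)"
    unfolding orthogonal_decomposition_def
  proof (intro conjI ballI allI impI)
    fix i j x y
    assume ij: "i \<in> {1..card Z'}" "j \<in> {1..card Z'}" "i \<noteq> j"
      and x: "x \<in> (E \<circ> f) i" and y: "y \<in> (E \<circ> f) j"
    have "f i \<noteq> f j"
      using inj ij by (auto dest: inj_onD)
    then show "cinner x y = 0"
      using generalized_eigenspaces_orthogonal[OF T poly unimod[OF fZ[OF ij(2)]], of "f i" "k (f i)" x "k (f j)" y]
        x y by (simp add: E_def A_def)
  next
    fix h
    obtain g where g: "\<forall>z\<in>Z'. g z \<in> E z" "h = (\<Sum>z\<in>Z'. g z)"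
      using dec' by blast
    show "\<exists>g. (\<forall>j\<in>{1..card Z'}. g j \<in> (E \<circ> f) j) \<and> h = (\<Sum>j=1..card Z'. g j)"
      using g fZ sum.reindex_bij_betw[OF f, of g] by (intro exI[of _ "g \<circ> f"]) auto
  qed (simp add: sub)
  ultimately have "unimodular_nilpotent_decomposition T (card Z') f (E \<circ> f) (\<lambda>j. A (f j))"
    unfolding unimodular_nilpotent_decomposition_def
  proof (intro conjI ballI)
    fix j assume j: "j \<in> {1..card Z'}"
    show "(E \<circ> f) j \<noteq> {0}" "T ` (E \<circ> f) j \<subseteq> (E \<circ> f) j" "cmod (f j) = 1"
      using fZ[OF j] unimod invT by (auto simp: Z'_def)
    show "clinear_on ((E \<circ> f) j) (A (f j))"
      using invA by (auto simp: clinear_on_def clinear_add[OF A] clinear_scaleC[OF A])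
    show "nilpotent_on ((E \<circ> f) j) (A (f j))"
      unfolding nilpotent_on_def using k[OF fZ[OF j]] by (intro exI[of _ "k (f j)"]) (simp add: E_def)
    show "T h = f j *\<^sub>C h + A (f j) h" for h
      by (simp add: A_def)
  qed (use inj in auto)
  then show ?thesis
    by blast
qed

section \<open>Orthogonal decompositions\<close>

lemma orthogonal_decomposition_cinner:
  assumes "orthogonal_decomposition \<kappa> M" "i \<in> {1..\<kappa>}" "j \<in> {1..\<kappa>}" "i \<noteq> j"
    "x \<in> M i" "y \<in> M j"
  shows "cinner x y = 0"
  using assms unfolding orthogonal_decomposition_def by blast

text \<open>Pairing the vanishing sum of differences with its \<open>i\<close>-th summand leaves
  only the squared norm of that summand.\<close>

lemma orthogonal_decomposition_unique:
  assumes M: "orthogonal_decomposition \<kappa> M"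
    and g: "\<And>j. j \<in> {1..\<kappa>} \<Longrightarrow> g j \<in> M j" "\<And>j. j \<in> {1..\<kappa>} \<Longrightarrow> g' j \<in> M j"
    and eq: "(\<Sum>j=1..\<kappa>. g j) = (\<Sum>j=1..\<kappa>. g' j)" and i: "i \<in> {1..\<kappa>}"
  shows "g i = g' i"
proof -
  define d where "d j = g j - g' j" for j
  have d: "d j \<in> M j" if "j \<in> {1..\<kappa>}" for j
    using M g that by (simp add: d_def orthogonal_decomposition_def complex_vector.subspace_diff)
  have "cinner (d j) (d i) = 0" if "j \<in> {1..\<kappa>}" "j \<noteq> i" for j
    using orthogonal_decomposition_cinner[OF M that(1) i that(2) d[OF that(1)] d[OF i]] .
  then have "(\<Sum>j=1..\<kappa>. cinner (d j) (d i)) = (\<Sum>j\<in>{i}. cinner (d j) (d i))"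
    using i by (intro sum.mono_neutral_right) auto
  moreover have "(\<Sum>j=1..\<kappa>. d j) = 0"
    using eq by (simp add: d_def sum_subtractf)
  then have "(\<Sum>j=1..\<kappa>. cinner (d j) (d i)) = 0"
    by (simp flip: cinner_sum_left)
  ultimately show ?thesis
    by (simp add: cinner_self_eq_0_iff d_def)
qed

text \<open>Pythagoras: the mixed inner products vanish.\<close>

lemma norm_orthogonal_sum:
  assumes M: "orthogonal_decomposition \<kappa> M" and g: "\<And>j. j \<in> {1..\<kappa>} \<Longrightarrow> g j \<in> M j"
  shows "(norm (\<Sum>j=1..\<kappa>. g j))\<^sup>2 = (\<Sum>j=1..\<kappa>. (norm (g j))\<^sup>2)"
proof -
  have "cinner (g i) (\<Sum>j=1..\<kappa>. g j) = cinner (g i) (g i)" if i: "i \<in> {1..\<kappa>}" for i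
  proof -
    have "cinner (g i) (g j) = 0" if "j \<in> {1..\<kappa>}" "j \<noteq> i" for j
      using orthogonal_decomposition_cinner[OF M i that(1) _ g[OF i] g[OF that(1)]] that(2) by simp
    then have "(\<Sum>j=1..\<kappa>. cinner (g i) (g j)) = (\<Sum>j\<in>{i}. cinner (g i) (g j))"
      using i by (intro sum.mono_neutral_right) auto
    then show ?thesis
      by (simp add: cinner_sum_right)
  qed
  then have "cinner (\<Sum>j=1..\<kappa>. g j) (\<Sum>j=1..\<kappa>. g j) = (\<Sum>j=1..\<kappa>. cinner (g j) (g j))"
    by (simp add: cinner_sum_left)
  then show ?thesis
    unfolding cinner_self_eq_norm of_real_sum[symmetric] of_real_eq_iff .
qed

text \<open>The least vanishing power meets the description, and vanishing persists for higher
  powers, which gives uniqueness.\<close>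

lemma nilpotency_index_on:
  assumes "nilpotent_on M N" "M \<noteq> {0}" "0 \<in> M" "N 0 = 0"
  shows "nilpotency_index_on M N \<ge> 1" "\<And>h. h \<in> M \<Longrightarrow> (N ^^ nilpotency_index_on M N) h = 0"
    "\<exists>h\<in>M. (N ^^ (nilpotency_index_on M N - 1)) h \<noteq> 0"
proof -
  define P where "P k \<longleftrightarrow> (\<forall>h\<in>M. (N ^^ k) h = 0)" for k
  define l where "l = (LEAST k. P k)"
  have "P l"
    using assms(1) unfolding l_def nilpotent_on_def P_def[symmetric] by (metis LeastI)
  moreover have "\<not> P 0"
    using assms(2,3) by (auto simp: P_def)
  ultimately have "l \<noteq> 0"
    by metis
  then have l: "l \<ge> 1" "P l" "\<not> P (l - 1)"
    using \<open>P l\<close> not_less_Least[of "l - 1" P] by (simp_all flip: l_def)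
  have mono: "P j" if "P i" "i \<le> j" for i j
    using that assms(4) by (auto simp: P_def intro: funpow_zero_mono)
  have "nilpotency_index_on M N = l"
    unfolding nilpotency_index_on_def
  proof (rule the_equality)
    show "l \<ge> 1 \<and> (\<forall>h\<in>M. (N ^^ l) h = 0) \<and> (\<exists>h\<in>M. (N ^^ (l - 1)) h \<noteq> 0)"
      using l by (simp add: P_def)
  next
    fix k assume k: "k \<ge> 1 \<and> (\<forall>h\<in>M. (N ^^ k) h = 0) \<and> (\<exists>h\<in>M. (N ^^ (k - 1)) h \<noteq> 0)"
    then have "P k" "\<not> P (k - 1)"
      by (auto simp: P_def)
    then have "\<not> k \<le> l - 1" "\<not> l \<le> k - 1"
      using mono l by blast+
    then show "k = l"
      using k l(1) by linarith
  qed
  then show "nilpotency_index_on M N \<ge> 1" "\<And>h. h \<in> M \<Longrightarrow> (N ^^ nilpotency_index_on M N) h = 0"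
    "\<exists>h\<in>M. (N ^^ (nilpotency_index_on M N - 1)) h \<noteq> 0"
    using l by (auto simp: P_def)
qed

text \<open>\<open>V\<close> multiplies the \<open>j\<close>-th component by \<open>z j\<close>.
  Pythagoras makes it isometric, division by the \<open>z j\<close> makes it surjective, and
  invariance of the subspaces makes it commute with \<open>T\<close>.\<close>

lemma unimodular_nilpotent_decomposition_split:
  fixes T :: "'a::complex_inner \<Rightarrow> 'a"
  assumes T: "clinear T" and dec: "unimodular_nilpotent_decomposition T \<kappa> z M N"
  obtains V where "unitary_op V" "V \<circ> T = T \<circ> V"
    and "\<And>j h. j \<in> {1..\<kappa>} \<Longrightarrow> h \<in> M j \<Longrightarrow> V h = z j *\<^sub>C h"
proof -
  have M: "orthogonal_decomposition \<kappa> M"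
    and inv: "\<And>j h. j \<in> {1..\<kappa>} \<Longrightarrow> h \<in> M j \<Longrightarrow> T h \<in> M j"
    and z: "\<And>j. j \<in> {1..\<kappa>} \<Longrightarrow> cmod (z j) = 1"
    using dec unfolding unimodular_nilpotent_decomposition_def image_subset_iff by blast+
  have sub: "csubspace (M j)" if "j \<in> {1..\<kappa>}" for j
    using M that by (simp add: orthogonal_decomposition_def)
  obtain G where G: "\<And>h j. j \<in> {1..\<kappa>} \<Longrightarrow> G h j \<in> M j" "\<And>h. h = (\<Sum>j=1..\<kappa>. G h j)"
    using M unfolding orthogonal_decomposition_def by metis
  have G_eq: "G h j = g j"
    if "h = (\<Sum>j=1..\<kappa>. g j)" "\<And>j. j \<in> {1..\<kappa>} \<Longrightarrow> g j \<in> M j" "j \<in> {1..\<kappa>}" for h g j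
  proof (rule orthogonal_decomposition_unique[OF M _ _ _ that(3)])
    show "(\<Sum>j=1..\<kappa>. G h j) = (\<Sum>j=1..\<kappa>. g j)"
      using G(2)[of h] that(1) by simp
  qed (auto simp: G(1) that(2))
  define V where "V h = (\<Sum>j=1..\<kappa>. z j *\<^sub>C G h j)" for h
  \<comment> \<open>By uniqueness of components, \<open>V\<close> may be computed from any
    decomposition of its argument, not only the chosen \<open>G\<close>.\<close>
  have V_sum: "V (\<Sum>j=1..\<kappa>. g j) = (\<Sum>j=1..\<kappa>. z j *\<^sub>C g j)"
    if "\<And>j. j \<in> {1..\<kappa>} \<Longrightarrow> g j \<in> M j" for g
    unfolding V_def using G_eq[OF refl that] by (intro sum.cong) simp_all
  have "clinear V"
    unfolding clinear_iff
  proof (intro conjI allI)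
    fix x y c
    have "x + y = (\<Sum>j=1..\<kappa>. G x j + G y j)"
      using G(2)[of x] G(2)[of y] by (simp add: sum.distrib)
    then have "V (x + y) = (\<Sum>j=1..\<kappa>. z j *\<^sub>C (G x j + G y j))"
      using V_sum[of "\<lambda>j. G x j + G y j"] G(1) sub by (simp add: complex_vector.subspace_add)
    then show "V (x + y) = V x + V y"
      by (simp add: V_def complex_vector.scale_right_distrib sum.distrib)
    have "c *\<^sub>C x = (\<Sum>j=1..\<kappa>. c *\<^sub>C G x j)"
      using G(2)[of x] by (simp flip: complex_vector.scale_sum_right)
    then have "V (c *\<^sub>C x) = (\<Sum>j=1..\<kappa>. z j *\<^sub>C c *\<^sub>C G x j)"
      using V_sum[of "\<lambda>j. c *\<^sub>C G x j"] G(1) sub by (simp add: complex_vector.subspace_scale)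
    then show "V (c *\<^sub>C x) = c *\<^sub>C V x"
      by (simp add: V_def complex_vector.scale_sum_right mult.commute)
  qed
  moreover have "norm (V h) = norm h" for h
  proof -
    have "(norm (V h))\<^sup>2 = (\<Sum>j=1..\<kappa>. (norm (z j *\<^sub>C G h j))\<^sup>2)"
      unfolding V_def using G(1) sub
      by (intro norm_orthogonal_sum[OF M]) (simp add: complex_vector.subspace_scale)
    also have "\<dots> = (\<Sum>j=1..\<kappa>. (norm (G h j))\<^sup>2)"
      by (simp add: norm_scaleC z)
    also have "\<dots> = (norm h)\<^sup>2"
      using norm_orthogonal_sum[OF M, of "G h"] G(1) G(2)[of h] by simp
    finally show ?thesis
      by simp
  qed
  moreover have "surj V"
  proof (rule surjI)
    fix h
    have "V (\<Sum>j=1..\<kappa>. inverse (z j) *\<^sub>C G h j) = (\<Sum>j=1..\<kappa>. z j *\<^sub>C inverse (z j) *\<^sub>C G h j)"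
      using G(1) sub by (intro V_sum) (simp add: complex_vector.subspace_scale)
    also have "\<dots> = (\<Sum>j=1..\<kappa>. G h j)"
    proof (intro sum.cong refl)
      fix j assume "j \<in> {1..\<kappa>}"
      then have "z j \<noteq> 0"
        using z by fastforce
      then show "z j *\<^sub>C inverse (z j) *\<^sub>C G h j = G h j"
        by simp
    qed
    finally show "V (\<Sum>j=1..\<kappa>. inverse (z j) *\<^sub>C G h j) = h"
      using G(2)[of h] by simp
  qed
  ultimately have "unitary_op V"
    by (simp add: unitary_op_def isometric_op_def)
  moreover have "V \<circ> T = T \<circ> V"
  proof
    fix h
    have "T h = (\<Sum>j=1..\<kappa>. T (G h j))"
      using G(2)[of h] by (simp flip: clinear_sum[OF T])
    then have "V (T h) = (\<Sum>j=1..\<kappa>. z j *\<^sub>C T (G h j))"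
      using V_sum[of "\<lambda>j. T (G h j)"] G(1) inv by simp
    then show "(V \<circ> T) h = (T \<circ> V) h"
      by (simp add: V_def clinear_sum[OF T] clinear_scaleC[OF T])
  qed
  moreover have "V h = z j *\<^sub>C h" if j: "j \<in> {1..\<kappa>}" and h: "h \<in> M j" for j h
  proof -
    \<comment> \<open>A vector of \<open>M j\<close> is decomposed with all other components
      zero.\<close>
    have "V (\<Sum>i=1..\<kappa>. if i = j then h else 0) = (\<Sum>i=1..\<kappa>. z i *\<^sub>C (if i = j then h else 0))"
      using h sub by (intro V_sum) (auto simp: complex_vector.subspace_0)
    then show ?thesis
      using j by (simp add: if_distrib[of "\<lambda>x. _ *\<^sub>C x"] cong: if_cong)
  qed
  ultimately show ?thesis
    by (rule that)
qed

text \<open>The nilpotent part \<open>T - V\<close> restricts to \<open>N j\<close> on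
  \<open>M j\<close>, so its index is the largest of the indices of the blocks.\<close>

lemma unimodular_nilpotent_decomposition_imp_isometric_add_nilpotent:
  fixes T :: "'a::complex_inner \<Rightarrow> 'a"
  assumes T: "clinear T" and dec: "unimodular_nilpotent_decomposition T \<kappa> z M N"
  defines "K \<equiv> MAX j\<in>{1..\<kappa>}. nilpotency_index_on (M j) (N j)"
  obtains V N' where "unitary_op V" "clinear N'" "V \<circ> N' = N' \<circ> V" "T = (\<lambda>h. V h + N' h)"
    and "K \<ge> 1" "\<And>h. (N' ^^ K) h = 0" "\<exists>h. (N' ^^ (K - 1)) h \<noteq> 0"
    and "algebraic_op T"
proof -
  obtain V where V: "unitary_op V" "V \<circ> T = T \<circ> V"
    and V_eq: "\<And>j h. j \<in> {1..\<kappa>} \<Longrightarrow> h \<in> M j \<Longrightarrow> V h = z j *\<^sub>C h"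
    by (rule unimodular_nilpotent_decomposition_split[OF T dec]) blast
  have "\<kappa> \<ge> 1" and M: "orthogonal_decomposition \<kappa> M" and inj: "inj_on z {1..\<kappa>}"
    and nontriv: "\<And>j. j \<in> {1..\<kappa>} \<Longrightarrow> M j \<noteq> {0}"
    and lin: "\<And>j. j \<in> {1..\<kappa>} \<Longrightarrow> clinear_on (M j) (N j)"
    and nil: "\<And>j. j \<in> {1..\<kappa>} \<Longrightarrow> nilpotent_on (M j) (N j)"
    and T_eq: "\<And>j h. j \<in> {1..\<kappa>} \<Longrightarrow> h \<in> M j \<Longrightarrow> T h = z j *\<^sub>C h + N j h"
    using dec unfolding unimodular_nilpotent_decomposition_def by blast+
  have Vlin: "clinear V"
    using V(1) by (simp add: unitary_op_def isometric_op_def)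
  define n where "n j = nilpotency_index_on (M j) (N j)" for j
  have zero: "0 \<in> M j" if "j \<in> {1..\<kappa>}" for j
    using M that by (simp add: orthogonal_decomposition_def complex_vector.subspace_0)
  have "N j 0 = 0" if "j \<in> {1..\<kappa>}" for j
  proof -
    have "N j (0 *\<^sub>C 0) = 0 *\<^sub>C N j 0"
      using lin[OF that] zero[OF that] unfolding clinear_on_def by blast
    then show ?thesis
      by simp
  qed
  note index = nilpotency_index_on[OF nil nontriv zero this, folded n_def]
  define N' where "N' h = T h - V h" for h
  have N': "clinear N'"
    by (simp add: clinear_iff N'_def clinear_add[OF T] clinear_add[OF Vlin] clinear_scaleC[OF T]
        clinear_scaleC[OF Vlin] complex_vector.scale_right_diff_distrib)
  have N'_pow: "(N' ^^ i) h = (N j ^^ i) h \<and> (N j ^^ i) h \<in> M j"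
    if "j \<in> {1..\<kappa>}" "h \<in> M j" for i j h
  proof (induction i)
    case (Suc i)
    have "N j x \<in> M j" if "x \<in> M j" for x
      using lin[OF \<open>j \<in> {1..\<kappa>}\<close>] that by (auto simp: clinear_on_def)
    then show ?case
      using Suc that(1) by (simp add: N'_def T_eq V_eq)
  qed (simp add: that)
  have K: "K = Max (n ` {1..\<kappa>})"
    by (simp add: K_def n_def)
  have n_le: "n j \<le> K" if "j \<in> {1..\<kappa>}" for j
    unfolding K using that by (intro Max_ge) auto
  \<comment> \<open>A block attaining the maximum supplies the vector on which power
    \<open>K - 1\<close> does not vanish.\<close>
  have "K \<in> n ` {1..\<kappa>}"
    unfolding K using \<open>\<kappa> \<ge> 1\<close> by (intro Max_in) auto
  then obtain j0 where j0: "j0 \<in> {1..\<kappa>}" "K = n j0"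
    by auto
  have nilK: "(N' ^^ K) h = 0" if "j \<in> {1..\<kappa>}" "h \<in> M j" for j h
    using funpow_zero_mono[of N' "n j" h K] clinear_0[OF N'] n_le[OF that(1)] N'_pow[OF that]
      index(2)[OF that(1,1,1,1,2)] by simp
  show ?thesis
  proof
    show "unitary_op V" "clinear N'"
      by fact+
    show "V \<circ> N' = N' \<circ> V"
      using V(2) by (auto simp: fun_eq_iff N'_def clinear_diff[OF Vlin])
    show "T = (\<lambda>h. V h + N' h)"
      by (simp add: N'_def)
    show "K \<ge> 1"
      using index(1)[OF j0(1,1,1,1)] j0(2) by simp
    show "(N' ^^ K) h = 0" for h
    proof -
      obtain g where g: "\<forall>j\<in>{1..\<kappa>}. g j \<in> M j" "h = (\<Sum>j=1..\<kappa>. g j)"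
        using M unfolding orthogonal_decomposition_def by blast
      then show ?thesis
        using nilK by (simp add: clinear_sum[OF clinear_funpow[OF N']])
    qed
    show "\<exists>h. (N' ^^ (K - 1)) h \<noteq> 0"
      using index(3)[OF j0(1,1,1,1)] N'_pow[OF j0(1)] j0(2) by metis
    show "algebraic_op T"
    proof (rule algebraic_op_if_primary_decomposition[OF T, of "z ` {1..\<kappa>}" "\<lambda>_. K"])
      fix h
      obtain g where g: "\<forall>j\<in>{1..\<kappa>}. g j \<in> M j" "h = (\<Sum>j=1..\<kappa>. g j)"
        using M unfolding orthogonal_decomposition_def by blast
      \<comment> \<open>Since the \<open>z j\<close> are distinct, components can be indexed by
        eigenvalues instead of by \<open>j\<close>.\<close>
      define c where "c = g \<circ> the_inv_into {1..\<kappa>} z"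
      have c: "c (z j) = g j" if "j \<in> {1..\<kappa>}" for j
        using the_inv_into_f_f[OF inj that] by (simp add: c_def)
      have shift: "((\<lambda>x. T x - z j *\<^sub>C x) ^^ i) x = (N' ^^ i) x"
        if "j \<in> {1..\<kappa>}" "x \<in> M j" for i j x
        using N'_pow[OF that] by (induction i) (simp_all add: N'_def V_eq[OF that(1)])
      have "h = (\<Sum>w\<in>z ` {1..\<kappa>}. c w)"
        unfolding sum.reindex[OF inj] using g(2) c by simp
      moreover have "\<forall>w\<in>z ` {1..\<kappa>}. ((\<lambda>x. T x - w *\<^sub>C x) ^^ K) (c w) = 0"
        using g(1) nilK shift by (auto simp: c)
      ultimately show "\<exists>g. h = (\<Sum>w\<in>z ` {1..\<kappa>}. g w) \<and>
          (\<forall>w\<in>z ` {1..\<kappa>}. ((\<lambda>x. T x - w *\<^sub>C x) ^^ K) (g w) = 0)"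
        by blast
    qed simp
  qed
qed

section \<open>The equivalences and the exact order\<close>

theorem proposition6p3:
  fixes T :: "'a::complex_inner \<Rightarrow> 'a"
  assumes "(UNIV :: 'a set) \<noteq> {0}" and "clinear T"
  shows
    "(let i = algebraic_op T \<and> (\<exists>m\<ge>1. m_isometry m T);
          ii = algebraic_op T \<and>
            (\<forall>h. polynomial_seq (\<lambda>n. complex_of_real ((norm ((T ^^ n) h))\<^sup>2)));
          iii = (\<exists>\<kappa> z M N. unimodular_nilpotent_decomposition T \<kappa> z M N);
          iv_isometric = algebraic_op T \<and>
            (\<exists>V N. isometric_op V \<and> clinear N \<and> nilpotent_on UNIV N \<and>
              V \<circ> N = N \<circ> V \<and> T = (\<lambda>h. V h + N h));
          iv_unitary = algebraic_op T \<and>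
            (\<exists>V N. unitary_op V \<and> clinear N \<and> nilpotent_on UNIV N \<and>
              V \<circ> N = N \<circ> V \<and> T = (\<lambda>h. V h + N h))
      in (i \<longleftrightarrow> ii) \<and> (i \<longleftrightarrow> iii) \<and> (i \<longleftrightarrow> iv_isometric) \<and> (i \<longleftrightarrow> iv_unitary)) \<and>
     (\<forall>\<kappa> z M N. unimodular_nilpotent_decomposition T \<kappa> z M N \<longrightarrow>
        strict_m_isometry (MAX j\<in>{1..\<kappa>}. 2 * nilpotency_index_on (M j) (N j) - 1) T)"
proof -
  have i_ii: "polynomial_seq (\<lambda>n. complex_of_real ((norm ((T ^^ n) h))\<^sup>2))"
    if "m_isometry m T" for m h
    using that by (rule polynomial_seq_norm_if_m_isometry)
  have ii_iii: "\<exists>\<kappa> z M N. unimodular_nilpotent_decomposition T \<kappa> z M N"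
    if "algebraic_op T" "\<forall>h. polynomial_seq (\<lambda>n. complex_of_real ((norm ((T ^^ n) h))\<^sup>2))"
    using unimodular_nilpotent_decomposition_exists[OF assms that(1)] that(2) by blast
  have iii_iv: "algebraic_op T \<and> (\<exists>V N. unitary_op V \<and> clinear N \<and> nilpotent_on UNIV N \<and>
      V \<circ> N = N \<circ> V \<and> T = (\<lambda>h. V h + N h))"
    if "unimodular_nilpotent_decomposition T \<kappa> z M N" for \<kappa> z M N
    by (rule unimodular_nilpotent_decomposition_imp_isometric_add_nilpotent[OF assms(2) that])
      (unfold nilpotent_on_def, blast)
  have iv_i: "\<exists>m\<ge>1. m_isometry m T"
    if V: "isometric_op V" and N: "clinear N" and nil: "nilpotent_on UNIV N"
      and comm: "V \<circ> N = N \<circ> V" and T: "T = (\<lambda>h. V h + N h)" for V N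
  proof -
    obtain k where k: "k \<ge> 1" "\<And>h. (N ^^ k) h = 0"
      using nil by (auto simp: nilpotent_on_def)
    have "m_isometry (2 * k - 1) T"
      using m_isometry_isometric_add_nilpotent[of T V N k] T V N comm k by blast
    then show ?thesis
      using k(1) by (intro exI[of _ "2 * k - 1"]) simp
  qed
  have unitary: "isometric_op V" if "unitary_op V" for V :: "'a \<Rightarrow> 'a"
    using that by (simp add: unitary_op_def)
  have strict: "strict_m_isometry (MAX j\<in>{1..\<kappa>}. 2 * nilpotency_index_on (M j) (N j) - 1) T"
    if dec: "unimodular_nilpotent_decomposition T \<kappa> z M N" for \<kappa> z M N
  proof -
    define K where "K = (MAX j\<in>{1..\<kappa>}. nilpotency_index_on (M j) (N j))"
    have "strict_m_isometry (2 * K - 1) T"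
    proof (rule unimodular_nilpotent_decomposition_imp_isometric_add_nilpotent[OF assms(2) dec, folded K_def])
      fix V N'
      assume "unitary_op V" "clinear N'" "V \<circ> N' = N' \<circ> V" "T = (\<lambda>h. V h + N' h)" "K \<ge> 1"
        "\<And>h. (N' ^^ K) h = 0" "\<exists>h. (N' ^^ (K - 1)) h \<noteq> 0"
      then show ?thesis
        using strict_m_isometry_isometric_add_nilpotent[of T V N' K] unitary by blast
    qed
    moreover have "\<kappa> \<ge> 1"
      using dec by (simp add: unimodular_nilpotent_decomposition_def)
    \<comment> \<open>The map \<open>k\<close> to \<open>2 * k - 1\<close> is monotone, so it
      commutes with the maximum of a nonempty finite set.\<close>
    then have "2 * K - 1 = (MAX j\<in>{1..\<kappa>}. 2 * nilpotency_index_on (M j) (N j) - 1)"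
      unfolding K_def
      by (subst mono_Max_commute[where f = "\<lambda>k. 2 * k - 1"]) (auto simp: mono_def image_image)
    ultimately show ?thesis
      by simp
  qed
  define i where "i \<longleftrightarrow> algebraic_op T \<and> (\<exists>m\<ge>1. m_isometry m T)"
  define ii where "ii \<longleftrightarrow> algebraic_op T \<and>
    (\<forall>h. polynomial_seq (\<lambda>n. complex_of_real ((norm ((T ^^ n) h))\<^sup>2)))"
  define iii where "iii \<longleftrightarrow> (\<exists>\<kappa> z M N. unimodular_nilpotent_decomposition T \<kappa> z M N)"
  define iv_isometric where "iv_isometric \<longleftrightarrow> algebraic_op T \<and>
    (\<exists>V N. isometric_op V \<and> clinear N \<and> nilpotent_on UNIV N \<and> V \<circ> N = N \<circ> V \<and> T = (\<lambda>h. V h + N h))"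
  define iv_unitary where "iv_unitary \<longleftrightarrow> algebraic_op T \<and>
    (\<exists>V N. unitary_op V \<and> clinear N \<and> nilpotent_on UNIV N \<and> V \<circ> N = N \<circ> V \<and> T = (\<lambda>h. V h + N h))"
  \<comment> \<open>The implications form one cycle, with the unitary variant passing to the
    isometric one before returning to \<open>i\<close>.\<close>
  have "i \<Longrightarrow> ii"
    using i_ii unfolding i_def ii_def by blast
  moreover have "ii \<Longrightarrow> iii"
    using ii_iii unfolding ii_def iii_def by blast
  moreover have "iii \<Longrightarrow> iv_unitary"
    using iii_iv unfolding iii_def iv_unitary_def by blast
  moreover have "iv_unitary \<Longrightarrow> iv_isometric"
    using unitary unfolding iv_unitary_def iv_isometric_def by blast
  moreover have "iv_isometric \<Longrightarrow> i"
    using iv_i unfolding iv_isometric_def i_def by blast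
  ultimately have "(i \<longleftrightarrow> ii) \<and> (i \<longleftrightarrow> iii) \<and> (i \<longleftrightarrow> iv_isometric) \<and> (i \<longleftrightarrow> iv_unitary)"
    by blast
  then show ?thesis
    using strict unfolding Let_def i_def ii_def iii_def iv_isometric_def iv_unitary_def by blast
qed

end
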